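(* Let $\{P_k\}_{k\ge1}$ be binary matrices, $P_k$ of size $m_k\times n_k$ with $m_k,n_k\to\infty$, converging to an asymmetric graphon $W$ (i.e. $\delta_\Box(P_k,W)\to0$) which is nonzero almost everywhere. Let $\{A_k\},\{B_k\}$ be sequences of real $m_k\times n_k$ matrices, and suppose there are numbers $q,L$ with $\|A_k\|_*,\|B_k\|_*\le q\sqrt{m_kn_k}$ and $\|A_k\|_\infty,\|B_k\|_\infty\le L$ for all $k$. Then for every $\varepsilon>0$ there is $\delta>0$, depending only on $\varepsilon,q,L$, such that if $\limsup_{k\to\infty}\|(A_k-B_k)\circ P_k\|_{\bar F}\le\delta$ then $\limsup_{k\to\infty}\|A_k-B_k\|_{\bar F}\le\varepsilon$.
   Context: A binary matrix has entries in $\{0,1\}$. For an $m\times n$ real matrix $A$: $\|A\|_\infty=\max|a_{ij}|$; $\|A\|_*$ is the sum of singular values; $\|A\|_{\bar F}=\big(\frac1{mn}\sum_{i,j}a_{ij}^2\big)^{1/2}$; $\|A\|_\Box=\frac1{mn}\max\{|x^TAy|:x\in\mathbb{R}^m,y\in\mathbb{R}^n,\|x\|_\infty\le1,\|y\|_\infty\le1\}$; $\circ$ is the entrywise product. $A^{\pi,\tau}$ has $(i,j)$ entry $a_{\pi(i)\tau(j)}$ for permutations $\pi,\tau$ of rows and columns, and $\delta_\Box(A,B)=\min_{\pi,\tau}\|A^{\pi,\tau}-B\|_\Box$. An asymmetric graphon is a Borel measurable $W:[0,1]^2\to[0,1]$; $W_{m,n}$ is the $m\times n$ matrix with $(i,j)$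 entry $mn\int_{(i-1)/m}^{i/m}\int_{(j-1)/n}^{j/n}W(x,y)\,dy\,dx$, and $\delta_\Box(A,W):=\delta_\Box(A,W_{m,n})$.
   Formalization: Here δ may depend on the fixed graphon W and sequence P_k as well as on ε, q, L; a δ independent of W is impossible: for W constant c and A_k−B_k all ones, the norm of (A_k−B_k)∘P_k tends to √c while that of A_k−B_k is 1. *)

theory Defs
  imports "Jordan_Normal_Form.Char_Poly" "HOL-Analysis.Analysis"
begin

definition binary_mat :: "real mat \<Rightarrow> bool" where
  "binary_mat A \<longleftrightarrow> (\<forall>i<dim_row A. \<forall>j<dim_col A. A $$ (i,j) \<in> {0,1})"

definition max_norm :: "real mat \<Rightarrow> real" where
  "max_norm A = Max (insert 0 {\<bar>A $$ (i,j)\<bar> | i j. i < dim_row A \<and> j < dim_col A})"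

text \<open>Nuclear norm = sum of singular values = sum (with multiplicity) of the square roots
  of the eigenvalues of A^T A (roots of its characteristic polynomial).\<close>
definition nuclear_norm :: "real mat \<Rightarrow> real" where
  "nuclear_norm A =
     (let p = char_poly (transpose_mat A * A)
      in \<Sum>e\<in>{x. poly p x = 0}. real (order e p) * sqrt e)"

definition nfrob_norm :: "real mat \<Rightarrow> real" where
  "nfrob_norm A = sqrt ((1 / (real (dim_row A) * real (dim_col A))) *
      (\<Sum>i<dim_row A. \<Sum>j<dim_col A. (A $$ (i,j))\<^sup>2))"

definition cut_norm :: "real mat \<Rightarrow> real" where
  "cut_norm A = (1 / (real (dim_row A) * real (dim_col A))) *
     Sup {\<bar>\<Sum>i<dim_row A. \<Sum>j<dim_col A. x i * A $$ (i,j) * y j\<bar> | x y.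
            (\<forall>i<dim_row A. \<bar>x i\<bar> \<le> 1) \<and> (\<forall>j<dim_col A. \<bar>y j\<bar> \<le> 1)}"

definition hadamard :: "real mat \<Rightarrow> real mat \<Rightarrow> real mat" (infixl "\<circ>\<^sub>H" 70) where
  "hadamard A B = Matrix.mat (dim_row A) (dim_col A) (\<lambda>(i,j). A $$ (i,j) * B $$ (i,j))"

definition perm_mat :: "real mat \<Rightarrow> (nat \<Rightarrow> nat) \<Rightarrow> (nat \<Rightarrow> nat) \<Rightarrow> real mat" where
  "perm_mat A \<pi> \<tau> = Matrix.mat (dim_row A) (dim_col A) (\<lambda>(i,j). A $$ (\<pi> i, \<tau> j))"

definition cut_dist :: "real mat \<Rightarrow> real mat \<Rightarrow> real" where
  "cut_dist A B = Min {cut_norm (perm_mat A \<pi> \<tau> - B) | \<pi> \<tau>.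
       \<pi> permutes {..<dim_row A} \<and> \<tau> permutes {..<dim_col A}}"

text \<open>An asymmetric graphon: Borel measurable W : [0,1]^2 \<rightarrow> [0,1]
  (represented on real \<times> real; values outside the unit square are irrelevant).\<close>
definition graphon :: "(real \<times> real \<Rightarrow> real) \<Rightarrow> bool" where
  "graphon W \<longleftrightarrow> W \<in> borel_measurable (restrict_space borel ({0..1} \<times> {0..1})) \<and>
     (\<forall>z\<in>{0..1} \<times> {0..1}. 0 \<le> W z \<and> W z \<le> 1)"

definition graphon_mat :: "(real \<times> real \<Rightarrow> real) \<Rightarrow> nat \<Rightarrow> nat \<Rightarrow> real mat" where
  "graphon_mat W m n = Matrix.mat m n (\<lambda>(i,j). real m * real n *
     set_lebesgue_integral lborel
       ({real i / real m .. real (Suc i) / real m} \<times> {real j / real n .. real (Suc j) / real n}) W)"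

definition cut_dist_graphon :: "real mat \<Rightarrow> (real \<times> real \<Rightarrow> real) \<Rightarrow> real" where
  "cut_dist_graphon A W = cut_dist A (graphon_mat W (dim_row A) (dim_col A))"

end

theory Submission
  imports Defs
begin

text \<open>Let \<open>M = A - B\<close>, let \<open>G\<close> be the suitably permuted matrix of the graphon and \<open>D = P - G\<close>.
  A matrix with bounded entries and small cut norm has small operator norm (relative to
  \<open>sqrt (m * n)\<close>). By nuclear/operator norm duality, \<open>x\<^sup>T (M \<circ> D) y\<close>, the inner product of \<open>M\<close> with
  \<open>diag x * D * diag y\<close>, is small for all \<open>x\<close>, \<open>y\<close> bounded by 1, so \<open>M \<circ> D\<close> again has small cut
  norm. Repeating the argument, the inner product of \<open>M\<close> with \<open>M \<circ> D\<close>, that is the sum of all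
  \<open>M i j\<^sup>2 * D i j\<close>, is small: the squares of \<open>M\<close> weighted by \<open>P\<close> and by \<open>G\<close> have nearly the same
  sum. Since the graphon is nonzero almost everywhere, \<open>G\<close> is at least \<open>c / 2\<close> outside a small
  fraction of the entries, and those contribute little as \<open>M\<close> is bounded.\<close>

section \<open>Spectral theorem for real symmetric matrices\<close>

lemma mult_mat_index_sum:
  assumes "A \<in> carrier_mat m n" "B \<in> carrier_mat n p" "i < m" "j < p"
  shows "(A * B) $$ (i,j) = (\<Sum>k<n. A $$ (i,k) * B $$ (k,j))"
  using assms by (simp add: scalar_prod_def lessThan_atLeast0)

text \<open>Over the complex numbers the characteristic polynomial has a root \<open>l\<close>, with
  eigenvector \<open>v = x + i y\<close>. Symmetry of \<open>s\<close> equates the two mixed forms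
  in \<open>x\<close> and \<open>y\<close>, which forces \<open>Im l\<close> times the squared
  length of \<open>v\<close> to vanish. So \<open>l\<close> is real, and \<open>x\<close> and
  \<open>y\<close> both satisfy the eigenvalue equation.\<close>

lemma symmetric_real_eigenvector:
  fixes s :: "nat \<Rightarrow> nat \<Rightarrow> real"
  assumes n: "n > 0" and sym: "\<And>i j. i < n \<Longrightarrow> j < n \<Longrightarrow> s i j = s j i"
  obtains e x where "(\<Sum>i<n. (x i)\<^sup>2) = 1" "\<And>i. i < n \<Longrightarrow> (\<Sum>j<n. s i j * x j) = e * x i"
proof -
  define C where "C = Matrix.mat n n (\<lambda>(i,j). complex_of_real (s i j))"
  have C: "C \<in> carrier_mat n n" by (simp add: C_def)
  have "degree (char_poly C) = n" using degree_monic_char_poly[OF C] by simp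
  then have "\<not> constant (poly (char_poly C))" using n by (simp add: constant_degree)
  then obtain l where "poly (char_poly C) l = 0" using fundamental_theorem_of_algebra by blast
  then have "eigenvalue C l" using eigenvalue_root_char_poly[OF C] by simp
  then obtain v where v: "v \<in> carrier_vec n" "v \<noteq> 0\<^sub>v n" and Cv: "C *\<^sub>v v = l \<cdot>\<^sub>v v"
    using C unfolding eigenvalue_def eigenvector_def by auto
  define x where "x i = Re (vec_index v i)" for i
  define y where "y i = Im (vec_index v i)" for i
  have eig: "(\<Sum>j<n. complex_of_real (s i j) * vec_index v j) = l * vec_index v i" if "i < n" for i
  proof -
    have "vec_index (C *\<^sub>v v) i = vec_index (l \<cdot>\<^sub>v v) i" using Cv by simp
    then show ?thesis using that v
      by (simp add: C_def scalar_prod_def lessThan_atLeast0)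
  qed
  have ex: "(\<Sum>j<n. s i j * x j) = Re l * x i - Im l * y i" if "i < n" for i
    using arg_cong[OF eig[OF that], of Re] by (simp add: x_def y_def)
  have ey: "(\<Sum>j<n. s i j * y j) = Re l * y i + Im l * x i" if "i < n" for i
    using arg_cong[OF eig[OF that], of Im] by (simp add: x_def y_def)
  have "(\<Sum>i<n. y i * (\<Sum>j<n. s i j * x j)) = (\<Sum>i<n. \<Sum>j<n. y i * (s i j * x j))"
    by (simp add: sum_distrib_left)
  also have "\<dots> = (\<Sum>j<n. \<Sum>i<n. y i * (s i j * x j))" by (rule sum.swap)
  also have "\<dots> = (\<Sum>j<n. \<Sum>i<n. x j * (s j i * y i))"
    by (intro sum.cong refl) (simp add: sym)
  also have "\<dots> = (\<Sum>i<n. x i * (\<Sum>j<n. s i j * y j))"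
    by (simp add: sum_distrib_left)
  finally have "(\<Sum>i<n. y i * (Re l * x i - Im l * y i)) = (\<Sum>i<n. x i * (Re l * y i + Im l * x i))"
    by (simp add: ex ey)
  moreover have "(\<Sum>i<n. Im l * ((x i)\<^sup>2 + (y i)\<^sup>2)) =
      (\<Sum>i<n. x i * (Re l * y i + Im l * x i)) - (\<Sum>i<n. y i * (Re l * x i - Im l * y i))"
    unfolding sum_subtractf[symmetric]
    by (intro sum.cong refl) (simp add: algebra_simps power2_eq_square)
  ultimately have "(\<Sum>i<n. Im l * ((x i)\<^sup>2 + (y i)\<^sup>2)) = 0" by simp
  then have b0: "Im l * (\<Sum>i<n. (x i)\<^sup>2 + (y i)\<^sup>2) = 0"
    by (simp only: sum_distrib_left)
  have "\<exists>i<n. vec_index v i \<noteq> 0"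
  proof (rule ccontr)
    assume "\<not> ?thesis"
    then have "v = 0\<^sub>v n" using v by (intro eq_vecI) auto
    with v show False by simp
  qed
  then obtain i0 where i0: "i0 < n" "vec_index v i0 \<noteq> 0" by auto
  then have p0: "0 < (x i0)\<^sup>2 + (y i0)\<^sup>2"
    by (auto simp: x_def y_def complex_eq_iff sum_power2_gt_zero_iff)
  also have "\<dots> \<le> (\<Sum>i<n. (x i)\<^sup>2 + (y i)\<^sup>2)"
    using i0 by (intro member_le_sum) auto
  finally have "Im l = 0" using b0 by auto
  with ex ey have ex: "(\<Sum>j<n. s i j * x j) = Re l * x i" and ey: "(\<Sum>j<n. s i j * y j) = Re l * y i"
    if "i < n" for i using that by auto
  \<comment> \<open>Whichever of \<open>x\<close> and \<open>y\<close> is nonzero at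
    \<open>i0\<close> serves as real eigenvector.\<close>
  have "\<exists>w. w i0 \<noteq> 0 \<and> (\<forall>i<n. (\<Sum>j<n. s i j * w j) = Re l * w i)"
  proof (cases "x i0 = 0")
    case True
    then have "y i0 \<noteq> 0" using p0 by auto
    then show ?thesis using ey by blast
  qed (use ex in blast)
  then obtain w where w: "w i0 \<noteq> 0" "\<And>i. i < n \<Longrightarrow> (\<Sum>j<n. s i j * w j) = Re l * w i" by blast
  define N where "N = (\<Sum>i<n. (w i)\<^sup>2)"
  have "0 < (w i0)\<^sup>2" using w by simp
  also have "\<dots> \<le> N" unfolding N_def using i0 by (intro member_le_sum) auto
  finally have N: "N > 0" .
  show thesis
  proof (rule that[of "\<lambda>i. w i / sqrt N" "Re l"])
    show "(\<Sum>i<n. (w i / sqrt N)\<^sup>2) = 1"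
      using N by (simp add: power_divide sum_divide_distrib[symmetric] N_def[symmetric])
    show "(\<Sum>j<n. s i j * (w j / sqrt N)) = Re l * (w i / sqrt N)" if "i < n" for i
      using w(2)[OF that] by (simp add: sum_divide_distrib[symmetric])
  qed
qed

text \<open>\<open>H\<close> is the reflection that exchanges the first unit vector and
  \<open>v\<close>. It serves to split off an eigenvector in the spectral theorem.\<close>

lemma householder:
  fixes v :: "nat \<Rightarrow> real"
  assumes n: "n > 0" and v: "(\<Sum>i<n. (v i)\<^sup>2) = 1"
  obtains H where "H \<in> carrier_mat n n" "transpose_mat H = H" "H * H = 1\<^sub>m n"
    "\<And>i. i < n \<Longrightarrow> H $$ (i,0) = v i"
proof -
  define w where "w i = v i - (if i = 0 then 1 else 0)" for i
  define N where "N = (\<Sum>i<n. (w i)\<^sup>2)"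
  \<comment> \<open>If \<open>v\<close> is the first unit vector, then \<open>N = 0\<close> and division by zero makes \<open>H\<close> the identity.\<close>
  define H where "H = Matrix.mat n n (\<lambda>(i,j). (if i = j then 1 else 0) - 2 * w i * w j / N)"
  \<comment> \<open>As \<open>v\<close> has length 1, its difference to the first unit vector has
    squared length \<open>2 - 2 * v 0\<close>. The resulting \<open>N = - 2 * w 0\<close> is what
    makes the first column of \<open>H\<close> equal to \<open>v\<close>.\<close>
  have "N = (\<Sum>i<n. (v i)\<^sup>2 - (if i = 0 then 2 * v 0 - 1 else 0))"
    unfolding N_def by (intro sum.cong) (auto simp: w_def power2_eq_square algebra_simps)
  also have "\<dots> = 1 - (2 * v 0 - 1)"
    using n v by (simp add: sum_subtractf sum.delta)
  finally have N: "N = - 2 * w 0" by (simp add: w_def)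
  have H: "H \<in> carrier_mat n n" by (simp add: H_def)
  have w0: "w i = 0" if "N = 0" "i < n" for i
    using that unfolding N_def by (subst (asm) sum_nonneg_eq_0_iff) auto
  show thesis
  proof (rule that[OF H])
    show "transpose_mat H = H" by (rule eq_matI) (auto simp: H_def)
    show "H * H = 1\<^sub>m n"
    proof (rule eq_matI)
      fix i j assume "i < dim_row (1\<^sub>m n :: real mat)" "j < dim_col (1\<^sub>m n :: real mat)"
      then have ij: "i < n" "j < n" by auto
      have "(H * H) $$ (i,j) = (\<Sum>k<n. ((if i = k then 1 else 0) - 2 * w i * w k / N) *
          ((if k = j then 1 else 0) - 2 * w k * w j / N))"
        using ij by (simp add: H_def scalar_prod_def lessThan_atLeast0)
      also have "\<dots> = (\<Sum>k<n. (if i = k then (if k = j then 1 else 0) - 2 * w k * w j / N else 0)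
          - (if k = j then 2 * w i * w k / N else 0) + 4 * w i * w j / N\<^sup>2 * (w k)\<^sup>2)"
        by (intro sum.cong) (auto simp: algebra_simps power2_eq_square)
      also have "\<dots> = (if i = j then 1 else 0) - 4 * w i * w j / N + 4 * w i * w j / N\<^sup>2 * N"
        unfolding N_def sum_distrib_left using ij by (simp add: sum_subtractf sum.distrib N_def[symmetric] mult.assoc)
      also have "\<dots> = (if i = j then 1 else 0)" by (simp add: power2_eq_square)
      finally show "(H * H) $$ (i,j) = 1\<^sub>m n $$ (i,j)" using ij by simp
    qed (use H in auto)
    show "H $$ (i,0) = v i" if "i < n" for i
    proof (cases "N = 0")
      case True
      then show ?thesis using w0[OF True that] n that by (auto simp: H_def w_def)
    next
      case False
      then have "2 * w i * w 0 / N = - w i" using N by (auto simp: field_simps)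
      then show ?thesis using n that by (auto simp: H_def w_def)
    qed
  qed
qed

text \<open>Induction on the size. Conjugation by a reflection \<open>H\<close> whose first column
  is a unit eigenvector splits off a 1 by 1 block. The induction hypothesis diagonalizes the
  remaining symmetric block by \<open>U'\<close>, and \<open>U\<close> is \<open>H\<close> times the
  block matrix of 1 and \<open>U'\<close>.\<close>

lemma real_spectral_theorem:
  fixes S :: "real mat"
  assumes "S \<in> carrier_mat n n" "transpose_mat S = S"
  shows "\<exists>U D. U \<in> carrier_mat n n \<and> D \<in> carrier_mat n n \<and> diagonal_mat D \<and>
    transpose_mat U * U = 1\<^sub>m n \<and> transpose_mat U * S * U = D"
  using assms
proof (induction n arbitrary: S)
  case 0
  then show ?case
    by (intro exI[of _ "1\<^sub>m 0"] exI[of _ "0\<^sub>m 0 0"]) (auto simp: diagonal_mat_def)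
next
  case (Suc n)
  note S = Suc.prems(1)
  have sym: "S $$ (i,j) = S $$ (j,i)" if "i < Suc n" "j < Suc n" for i j
    using arg_cong[OF Suc.prems(2), of "\<lambda>M. M $$ (i,j)"] that S by auto
  obtain e v where v: "(\<Sum>i<Suc n. (v i)\<^sup>2) = 1"
    "\<And>i. i < Suc n \<Longrightarrow> (\<Sum>j<Suc n. S $$ (i,j) * v j) = e * v i"
    by (rule symmetric_real_eigenvector[of "Suc n" "\<lambda>i j. S $$ (i,j)"]) (use sym in auto)
  obtain H where H: "H \<in> carrier_mat (Suc n) (Suc n)" "transpose_mat H = H" "H * H = 1\<^sub>m (Suc n)"
    and Hv: "\<And>i. i < Suc n \<Longrightarrow> H $$ (i,0) = v i"
    by (rule householder[OF zero_less_Suc v(1)]) metis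
  define R where "R = H * (S * H)"
  have R: "R \<in> carrier_mat (Suc n) (Suc n)" using H S by (simp add: R_def)
  have HS: "H * S \<in> carrier_mat (Suc n) (Suc n)" "S * H \<in> carrier_mat (Suc n) (Suc n)"
    using H S by auto
  have "transpose_mat R = transpose_mat (S * H) * transpose_mat H"
    unfolding R_def by (rule transpose_mult[OF H(1) HS(2)])
  also have "\<dots> = (H * S) * H" using transpose_mult[OF S H(1)] H Suc.prems by simp
  finally have Rt: "transpose_mat R = R" unfolding R_def using H S by (simp add: assoc_mult_mat)
  have Rsym: "R $$ (i,j) = R $$ (j,i)" if "i < Suc n" "j < Suc n" for i j
    using arg_cong[OF Rt, of "\<lambda>M. M $$ (i,j)"] that R by auto
  have SH: "(S * H) $$ (i,0) = e * H $$ (i,0)" if "i < Suc n" for i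
  proof -
    have "(S * H) $$ (i,0) = (\<Sum>j<Suc n. S $$ (i,j) * v j)"
      unfolding mult_mat_index_sum[OF S H(1) that zero_less_Suc] by (intro sum.cong refl) (simp add: Hv)
    then show ?thesis using v(2)[OF that] Hv[OF that] by simp
  qed
  \<comment> \<open>\<open>H\<close> sends the first unit vector to the eigenvector,
    \<open>S\<close> multiplies it by \<open>e\<close>, and \<open>H\<close> sends it back, being an
    involution.\<close>
  have R0: "R $$ (i,0) = e * (1\<^sub>m (Suc n) $$ (i,0))" if "i < Suc n" for i
  proof -
    have "R $$ (i,0) = (\<Sum>k<Suc n. H $$ (i,k) * (S * H) $$ (k,0))"
      unfolding R_def by (rule mult_mat_index_sum[OF H(1) HS(2) that zero_less_Suc])
    also have "\<dots> = e * (\<Sum>k<Suc n. H $$ (i,k) * H $$ (k,0))"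
      unfolding sum_distrib_left by (intro sum.cong refl) (simp add: SH)
    also have "(\<Sum>k<Suc n. H $$ (i,k) * H $$ (k,0)) = (H * H) $$ (i,0)"
      by (rule mult_mat_index_sum[OF H(1) H(1) that zero_less_Suc, symmetric])
    finally show ?thesis using H by simp
  qed
  define R' where "R' = Matrix.mat n n (\<lambda>(i,j). R $$ (Suc i, Suc j))"
  define E where "E = Matrix.mat 1 1 (\<lambda>_. e)"
  have R': "R' \<in> carrier_mat n n" by (simp add: R'_def)
  have E: "E \<in> carrier_mat 1 1" by (simp add: E_def)
  have "transpose_mat R' = R'" by (rule eq_matI) (auto simp: R'_def Rsym)
  from Suc.IH[OF R' this] obtain U' D' where U': "U' \<in> carrier_mat n n"
    and D': "D' \<in> carrier_mat n n" "diagonal_mat D'" and UU': "transpose_mat U' * U' = 1\<^sub>m n"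
    and RU': "transpose_mat U' * R' * U' = D'" by blast
  \<comment> \<open>Symmetry of \<open>R\<close> carries the zeros of the first column over to the
    first row.\<close>
  have Rb: "R = four_block_mat E (0\<^sub>m 1 n) (0\<^sub>m n 1) R'"
  proof (rule eq_matI)
    fix i j assume "i < dim_row (four_block_mat E (0\<^sub>m 1 n) (0\<^sub>m n 1) R')"
      "j < dim_col (four_block_mat E (0\<^sub>m 1 n) (0\<^sub>m n 1) R')"
    then have ij: "i < Suc n" "j < Suc n" using E R' by auto
    have "R $$ (0,j) = e * (1\<^sub>m (Suc n) $$ (j,0))" using R0[OF ij(2)] Rsym[of 0 j] ij by simp
    then show "R $$ (i,j) = four_block_mat E (0\<^sub>m 1 n) (0\<^sub>m n 1) R' $$ (i,j)"
      using ij R0[OF ij(1)] by (cases i; cases j) (auto simp: E_def R'_def)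
  qed (use R E R' in auto)
  define V where "V = four_block_mat (1\<^sub>m 1) (0\<^sub>m 1 n) (0\<^sub>m n 1) U'"
  define D where "D = four_block_mat E (0\<^sub>m 1 n) (0\<^sub>m n 1) D'"
  have V: "V \<in> carrier_mat (Suc n) (Suc n)" using U' unfolding V_def
    by (metis four_block_carrier_mat one_carrier_mat plus_1_eq_Suc)
  have D: "D \<in> carrier_mat (Suc n) (Suc n)" using D' E unfolding D_def
    by (metis four_block_carrier_mat plus_1_eq_Suc)
  have Vt: "transpose_mat V = four_block_mat (1\<^sub>m 1) (0\<^sub>m 1 n) (0\<^sub>m n 1) (transpose_mat U')"
    unfolding V_def using U' by (subst transpose_four_block_mat) auto
  have VV: "transpose_mat V * V = 1\<^sub>m (Suc n)"
    unfolding Vt unfolding V_def using U' UU'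
    by (subst mult_four_block_mat[where ?nr1.0=1 and ?nc1.0=1 and ?n1.0=1 and ?nr2.0=n and ?nc2.0=n and ?n2.0=n]) auto
  have "transpose_mat V * R * V = D"
    unfolding Vt Rb unfolding V_def D_def using U' RU' E R'
    by (subst mult_four_block_mat[where ?nr1.0=1 and ?nc1.0=1 and ?n1.0=1 and ?nr2.0=n and ?nc2.0=n and ?n2.0=n], auto)
      (subst mult_four_block_mat[where ?nr1.0=1 and ?nc1.0=1 and ?n1.0=1 and ?nr2.0=n and ?nc2.0=n and ?n2.0=n], auto)
  moreover define U where "U = H * V"
  have U: "U \<in> carrier_mat (Suc n) (Suc n)" using H V by (simp add: U_def)
  have Ut: "transpose_mat U = transpose_mat V * H"
    unfolding U_def using transpose_mult[OF H(1) V] H by simp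
  have Vt': "transpose_mat V \<in> carrier_mat (Suc n) (Suc n)" using V by simp
  have "transpose_mat U * U = transpose_mat V * (H * H) * V"
    unfolding Ut unfolding U_def using Vt' V H(1) by (simp add: assoc_mult_mat[of _ "Suc n" "Suc n" _ "Suc n" _ "Suc n"])
  then have "transpose_mat U * U = 1\<^sub>m (Suc n)" using H(3) VV V by simp
  moreover have "transpose_mat U * S * U = transpose_mat V * R * V"
    unfolding Ut R_def unfolding U_def using Vt' V H(1) S by (simp add: assoc_mult_mat[of _ "Suc n" "Suc n" _ "Suc n" _ "Suc n"])
  moreover have "diagonal_mat D"
    using D' E unfolding diagonal_mat_def D_def by auto
  ultimately show ?case using U D by metis
qed

section \<open>Nuclear norm and cut norm\<close>

text \<open>Orders add up over products, so a repeated entry counts once per factor. This turns the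
  sum over roots in \<open>nuclear_norm\<close> into a sum over the diagonal of a diagonalized
  matrix.\<close>

lemma sum_order_prod_list:
  fixes xs :: "real list"
  defines "p \<equiv> (\<Prod>a\<leftarrow>xs. [:- a, 1:])"
  shows "(\<Sum>e\<in>{x. poly p x = 0}. real (order e p) * f e) = (\<Sum>x\<leftarrow>xs. f x)"
proof -
  have nz: "(\<Prod>a\<leftarrow>xs. [:- a, 1:]) \<noteq> 0" for xs :: "real list"
    by (auto simp: prod_list_zero_iff)
  have lin: "order e [:- a, 1:] = (if e = a then 1 else 0)" for e a :: real
    using order_power_n_n[of a 1] by (auto simp: order_0I)
  \<comment> \<open>Stated for every finite superset \<open>F\<close> of the roots, as the root set
    itself may change when a factor is removed. Points of \<open>F\<close> that are not roots have
    order 0.\<close>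
  have fin: "finite F \<Longrightarrow> set xs \<subseteq> F \<Longrightarrow>
    (\<Sum>e\<in>F. real (order e (\<Prod>a\<leftarrow>xs. [:- a, 1:])) * f e) = (\<Sum>x\<leftarrow>xs. f x)" for F xs
  proof (induction xs)
    case Nil
    then show ?case by simp
  next
    case (Cons a xs)
    have "(\<Sum>e\<in>F. real (order e (\<Prod>a\<leftarrow>a#xs. [:- a, 1:])) * f e) =
        (\<Sum>e\<in>F. (if e = a then f e else 0) + real (order e (\<Prod>a\<leftarrow>xs. [:- a, 1:])) * f e)"
    proof (intro sum.cong refl)
      fix e
      have "order e (\<Prod>a\<leftarrow>a#xs. [:- a, 1:]) = order e [:- a, 1:] + order e (\<Prod>a\<leftarrow>xs. [:- a, 1:])"
        using order_mult[of "[:- a, 1:]" "\<Prod>a\<leftarrow>xs. [:- a, 1:]" e] nz[of "a#xs"] by simp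
      then show "real (order e (\<Prod>a\<leftarrow>a#xs. [:- a, 1:])) * f e =
          (if e = a then f e else 0) + real (order e (\<Prod>a\<leftarrow>xs. [:- a, 1:])) * f e"
        unfolding lin by (simp add: algebra_simps)
    qed
    then show ?case using Cons by (simp add: sum.distrib)
  qed
  have "{x. poly p x = 0} = set xs"
    unfolding p_def by (auto simp: poly_prod_list prod_list_zero_iff o_def)
  then show ?thesis unfolding p_def using fin[of "set xs" xs] by simp
qed

text \<open>The columns of \<open>U\<close> are orthonormal eigenvectors of
  \<open>transpose_mat A * A\<close>. The eigenvalue of column \<open>l\<close> is the squared
  length of column \<open>l\<close> of \<open>A * U\<close>, so these columns have the singular
  values as lengths.\<close>

lemma nuclear_norm_spectral:
  assumes A: "A \<in> carrier_mat m n"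
  obtains U where "U \<in> carrier_mat n n" "transpose_mat U * U = 1\<^sub>m n" "U * transpose_mat U = 1\<^sub>m n"
    "nuclear_norm A = (\<Sum>l<n. sqrt (\<Sum>i<m. ((A * U) $$ (i,l))\<^sup>2))"
proof -
  define S where "S = transpose_mat A * A"
  have At: "transpose_mat A \<in> carrier_mat n m" using A by simp
  have S: "S \<in> carrier_mat n n" using A by (simp add: S_def)
  have "transpose_mat S = S" unfolding S_def using transpose_mult[OF At A] by simp
  then obtain U D where U: "U \<in> carrier_mat n n" and D: "D \<in> carrier_mat n n" "diagonal_mat D"
    and UU: "transpose_mat U * U = 1\<^sub>m n" and USU: "transpose_mat U * S * U = D"
    using real_spectral_theorem[OF S] by blast
  have Ut: "transpose_mat U \<in> carrier_mat n n" using U by simp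
  have UU': "U * transpose_mat U = 1\<^sub>m n" using mat_mult_left_right_inverse[OF Ut U UU] .
  have AU: "A * U \<in> carrier_mat m n" using A U by simp
  have "U * D * transpose_mat U = (U * transpose_mat U) * S * (U * transpose_mat U)"
    unfolding USU[symmetric] using U Ut S by (simp add: assoc_mult_mat[of _ n n _ n _ n])
  then have "S = U * D * transpose_mat U" using UU' S by simp
  then have "similar_mat_wit S D U (transpose_mat U)"
    unfolding similar_mat_wit_def Let_def using S D U Ut UU UU' by auto
  then have "similar_mat S D" unfolding similar_mat_def by blast
  then have "char_poly S = char_poly D" by (rule char_poly_similar)
  also have "\<dots> = (\<Prod>a\<leftarrow>diag_mat D. [:- a, 1:])"
    using D by (intro char_poly_upper_triangular[of _ n]) (auto simp: diagonal_mat_def upper_triangular_def)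
  finally have "nuclear_norm A = (\<Sum>x\<leftarrow>diag_mat D. sqrt x)"
    unfolding nuclear_norm_def Let_def S_def[symmetric] using sum_order_prod_list by simp
  also have "\<dots> = (\<Sum>l<n. sqrt (D $$ (l,l)))"
    using D unfolding diag_mat_def
    by (simp add: o_def interv_sum_list_conv_sum_set_nat lessThan_atLeast0)
  also have "\<dots> = (\<Sum>l<n. sqrt (\<Sum>i<m. ((A * U) $$ (i,l))\<^sup>2))"
  proof (intro sum.cong refl arg_cong[of _ _ sqrt])
    fix l assume "l \<in> {..<n}"
    then have l: "l < n" by simp
    have "D = transpose_mat (A * U) * (A * U)"
      unfolding USU[symmetric] S_def transpose_mult[OF A U]
      using A U At Ut by (simp add: assoc_mult_mat[of _ n n _ n _ n] assoc_mult_mat[of _ n n _ m _ n]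
        assoc_mult_mat[of _ n m _ n _ n])
    then have "D $$ (l,l) = (\<Sum>i<m. transpose_mat (A * U) $$ (l,i) * (A * U) $$ (i,l))"
      using mult_mat_index_sum[of "transpose_mat (A * U)" n m "A * U" n] AU l by simp
    also have "\<dots> = (\<Sum>i<m. ((A * U) $$ (i,l))\<^sup>2)"
      using A U l by (intro sum.cong refl) (auto simp: power2_eq_square)
    finally show "D $$ (l,l) = (\<Sum>i<m. ((A * U) $$ (i,l))\<^sup>2)" .
  qed
  finally show thesis using that[OF U UU UU'] by simp
qed

text \<open>The hypothesis on \<open>x\<close> bounds its operator norm by \<open>K\<close>.
  Multiplying both matrices by the orthogonal \<open>U\<close> preserves their inner product, after
  which Cauchy-Schwarz applies column by column: the lengths of the columns of \<open>A * U\<close>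
  add up to the nuclear norm, and those of \<open>X * U\<close> are at most
  \<open>K\<close>.\<close>

lemma nuclear_norm_duality:
  assumes A: "A \<in> carrier_mat m n" and K: "K \<ge> 0"
    and X: "\<And>y. (\<Sum>i<m. (\<Sum>j<n. x i j * y j)\<^sup>2) \<le> K\<^sup>2 * (\<Sum>j<n. (y j)\<^sup>2)"
  shows "\<bar>\<Sum>i<m. \<Sum>j<n. A $$ (i,j) * x i j\<bar> \<le> K * nuclear_norm A"
proof -
  obtain U where U: "U \<in> carrier_mat n n" "transpose_mat U * U = 1\<^sub>m n" "U * transpose_mat U = 1\<^sub>m n"
    and nuc: "nuclear_norm A = (\<Sum>l<n. sqrt (\<Sum>i<m. ((A * U) $$ (i,l))\<^sup>2))"
    using nuclear_norm_spectral[OF A] by metis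
  define X where "X = Matrix.mat m n (\<lambda>(i,j). x i j)"
  have X': "X \<in> carrier_mat m n" by (simp add: X_def)
  have AU: "A * U \<in> carrier_mat m n" and XU: "X * U \<in> carrier_mat m n" using A X' U by auto
  have Ut: "transpose_mat U \<in> carrier_mat n n" and Xt: "transpose_mat X \<in> carrier_mat n m" using U X' by auto
  have XUt: "transpose_mat (X * U) \<in> carrier_mat n m" using XU by simp
  \<comment> \<open>The inner product is the trace of this product; inserting
    \<open>U * transpose_mat U\<close> rewrites it in terms of \<open>A * U\<close> and
    \<open>X * U\<close>.\<close>
  have "A * transpose_mat X = A * (U * transpose_mat U) * transpose_mat X" using A U by simp
  also have "\<dots> = (A * U) * transpose_mat (X * U)"
    unfolding transpose_mult[OF X' U(1)] using A U(1) Ut Xt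
    by (simp add: assoc_mult_mat[of _ m n _ n _ n] assoc_mult_mat[of _ m n _ n _ m] assoc_mult_mat[of _ n n _ n _ m])
  finally have eq: "A * transpose_mat X = (A * U) * transpose_mat (X * U)" .
  have "(\<Sum>i<m. \<Sum>j<n. A $$ (i,j) * x i j) = (\<Sum>i<m. (A * transpose_mat X) $$ (i,i))"
    using mult_mat_index_sum[OF A Xt] by (intro sum.cong refl) (simp add: X_def)
  also have "\<dots> = (\<Sum>i<m. \<Sum>l<n. (A * U) $$ (i,l) * (X * U) $$ (i,l))"
    unfolding eq using mult_mat_index_sum[OF AU XUt] XU U(1) X' by (intro sum.cong refl) (auto intro!: sum.cong)
  also have "\<dots> = (\<Sum>l<n. \<Sum>i<m. (A * U) $$ (i,l) * (X * U) $$ (i,l))" by (rule sum.swap)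
  finally have "\<bar>\<Sum>i<m. \<Sum>j<n. A $$ (i,j) * x i j\<bar> \<le>
      (\<Sum>l<n. \<bar>\<Sum>i<m. (A * U) $$ (i,l) * (X * U) $$ (i,l)\<bar>)" by (simp add: sum_abs)
  also have "\<dots> \<le> (\<Sum>l<n. K * sqrt (\<Sum>i<m. ((A * U) $$ (i,l))\<^sup>2))"
  proof (intro sum_mono)
    fix l assume "l \<in> {..<n}"
    then have l: "l < n" by simp
    \<comment> \<open>Column \<open>l\<close> of \<open>X * U\<close> is the image of column
      \<open>l\<close> of \<open>U\<close>, a unit vector.\<close>
    have "(\<Sum>i<m. ((X * U) $$ (i,l))\<^sup>2) = (\<Sum>i<m. (\<Sum>j<n. x i j * U $$ (j,l))\<^sup>2)"
      using mult_mat_index_sum[OF X' U(1) _ l] by (intro sum.cong refl) (simp add: X_def)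
    also have "\<dots> \<le> K\<^sup>2 * (\<Sum>j<n. (U $$ (j,l))\<^sup>2)" by (rule X)
    also have "(\<Sum>j<n. (U $$ (j,l))\<^sup>2) = (transpose_mat U * U) $$ (l,l)"
      using mult_mat_index_sum[OF Ut U(1) l l] U(1) l by (simp add: power2_eq_square)
    finally have XK: "(\<Sum>i<m. ((X * U) $$ (i,l))\<^sup>2) \<le> K\<^sup>2" using U l by simp
    have "\<bar>\<Sum>i<m. (A * U) $$ (i,l) * (X * U) $$ (i,l)\<bar> \<le> (\<Sum>i<m. \<bar>(A * U) $$ (i,l)\<bar> * \<bar>(X * U) $$ (i,l)\<bar>)"
      by (rule order_trans[OF sum_abs]) (simp add: abs_mult)
    also have "\<dots> \<le> L2_set (\<lambda>i. (A * U) $$ (i,l)) {..<m} * L2_set (\<lambda>i. (X * U) $$ (i,l)) {..<m}"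
      by (rule L2_set_mult_ineq)
    also have "\<dots> \<le> sqrt (\<Sum>i<m. ((A * U) $$ (i,l))\<^sup>2) * K"
      unfolding L2_set_def using XK K by (intro mult_left_mono) (auto simp: real_le_lsqrt sum_nonneg)
    finally show "\<bar>\<Sum>i<m. (A * U) $$ (i,l) * (X * U) $$ (i,l)\<bar> \<le> K * sqrt (\<Sum>i<m. ((A * U) $$ (i,l))\<^sup>2)"
      by (simp add: mult.commute)
  qed
  also have "\<dots> = K * nuclear_norm A" unfolding nuc by (simp add: sum_distrib_left)
  finally show ?thesis .
qed

text \<open>The fourth power of the operator norm is at most the signed count of 4-cycles
  \<open>d i j * d i k * d h j * d h k\<close>. For fixed \<open>h\<close> and \<open>k\<close> this is a bilinear form of \<open>d\<close> in
  \<open>d i k\<close> and \<open>d h j\<close>, which the cut bound controls.\<close>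

lemma cut_bound_imp_operator_bound:
  fixes d :: "nat \<Rightarrow> nat \<Rightarrow> real"
  assumes b: "b > 0" and db: "\<And>i j. i < m \<Longrightarrow> j < n \<Longrightarrow> \<bar>d i j\<bar> \<le> b"
    and cut: "\<And>x y. (\<And>i. i < m \<Longrightarrow> \<bar>x i\<bar> \<le> 1) \<Longrightarrow> (\<And>j. j < n \<Longrightarrow> \<bar>y j\<bar> \<le> 1) \<Longrightarrow>
        \<bar>\<Sum>i<m. \<Sum>j<n. x i * d i j * y j\<bar> \<le> c"
  shows "(\<Sum>i<m. (\<Sum>j<n. d i j * y j)\<^sup>2) \<le> sqrt (real m * real n * b ^ 3 * c) * (\<Sum>j<n. (y j)\<^sup>2)"
proof -
  define g where "g j k = (\<Sum>i<m. d i j * d i k)" for j k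
  define N where "N = {..<n} \<times> {..<n}"
  have cyc: "(\<Sum>(j,k)\<in>N. (g j k)\<^sup>2) \<le> real m * real n * b ^ 3 * c"
  proof -
    have "(\<Sum>(j,k)\<in>N. (g j k)\<^sup>2) = (\<Sum>j<n. \<Sum>k<n. \<Sum>i<m. \<Sum>h<m. (d i j * d i k) * (d h j * d h k))"
      by (simp add: N_def sum.cartesian_product[symmetric] g_def power2_eq_square sum_product)
    also have "\<dots> = (\<Sum>k<n. \<Sum>j<n. \<Sum>i<m. \<Sum>h<m. (d i j * d i k) * (d h j * d h k))"
      by (rule sum.swap)
    also have "\<dots> = (\<Sum>k<n. \<Sum>h<m. \<Sum>j<n. \<Sum>i<m. (d i j * d i k) * (d h j * d h k))"
    proof (rule sum.cong[OF refl])
      fix k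
      have "(\<Sum>j<n. \<Sum>i<m. \<Sum>h<m. (d i j * d i k) * (d h j * d h k)) =
          (\<Sum>j<n. \<Sum>h<m. \<Sum>i<m. (d i j * d i k) * (d h j * d h k))"
        by (rule sum.cong[OF refl], rule sum.swap)
      also have "\<dots> = (\<Sum>h<m. \<Sum>j<n. \<Sum>i<m. (d i j * d i k) * (d h j * d h k))"
        by (rule sum.swap)
      finally show "(\<Sum>j<n. \<Sum>i<m. \<Sum>h<m. (d i j * d i k) * (d h j * d h k)) = \<dots>" .
    qed
    \<comment> \<open>For fixed \<open>h\<close> and \<open>k\<close>, division by \<open>b\<close>
      makes \<open>d i k / b\<close> and \<open>d h j / b\<close> admissible test vectors in
      \<open>i\<close> and \<open>j\<close>. The factor \<open>b\<^sup>2\<close> compensates for it,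
      and \<open>d h k\<close> contributes the third \<open>b\<close> of the bound.\<close>
    also have "\<dots> = (\<Sum>k<n. \<Sum>h<m. d h k * b\<^sup>2 * (\<Sum>i<m. \<Sum>j<n. (d i k / b) * d i j * (d h j / b)))"
      unfolding sum_distrib_left
      by (rule sum.cong[OF refl], rule sum.cong[OF refl], subst sum.swap, intro sum.cong refl) (use b in \<open>simp add: power2_eq_square field_simps\<close>)
    also have "\<dots> \<le> (\<Sum>k<n. \<Sum>h<m. b ^ 3 * c)"
    proof (intro sum_mono)
      fix k h assume "k \<in> {..<n}" "h \<in> {..<m}"
      then have kh: "k < n" "h < m" by auto
      have c: "\<bar>\<Sum>i<m. \<Sum>j<n. (d i k / b) * d i j * (d h j / b)\<bar> \<le> c"
        using db kh b by (intro cut) (auto simp: divide_le_eq)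
      have "d h k * b\<^sup>2 * (\<Sum>i<m. \<Sum>j<n. (d i k / b) * d i j * (d h j / b)) \<le>
          \<bar>d h k * b\<^sup>2\<bar> * \<bar>\<Sum>i<m. \<Sum>j<n. (d i k / b) * d i j * (d h j / b)\<bar>"
        unfolding abs_mult[symmetric] by (rule abs_ge_self)
      also have "\<dots> \<le> (b * b\<^sup>2) * c"
        using c db[of h k] kh b by (intro mult_mono) (auto simp: abs_mult intro!: mult_right_mono)
      finally show "d h k * b\<^sup>2 * (\<Sum>i<m. \<Sum>j<n. (d i k / b) * d i j * (d h j / b)) \<le> b ^ 3 * c"
        by (simp add: power2_eq_square power3_eq_cube)
    qed
    also have "\<dots> = real m * real n * b ^ 3 * c" by simp
    finally show ?thesis .
  qed
  \<comment> \<open>The left side is the quadratic form of the Gram matrix \<open>g\<close> at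
    \<open>y\<close>. Cauchy-Schwarz over pairs \<open>(j,k)\<close> bounds it by the Frobenius norm
    of \<open>g\<close>, controlled by \<open>cyc\<close>, times the squared length of
    \<open>y\<close>.\<close>
  have "(\<Sum>i<m. (\<Sum>j<n. d i j * y j)\<^sup>2) = (\<Sum>i<m. \<Sum>j<n. \<Sum>k<n. (d i j * y j) * (d i k * y k))"
    by (simp add: power2_eq_square sum_product)
  also have "\<dots> = (\<Sum>j<n. \<Sum>i<m. \<Sum>k<n. (d i j * y j) * (d i k * y k))" by (rule sum.swap)
  also have "\<dots> = (\<Sum>j<n. \<Sum>k<n. \<Sum>i<m. (d i j * y j) * (d i k * y k))"
    by (rule sum.cong[OF refl], rule sum.swap)
  also have "\<dots> = (\<Sum>(j,k)\<in>N. g j k * (y j * y k))"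
    by (simp add: N_def sum.cartesian_product[symmetric] g_def sum_distrib_left sum_distrib_right mult_ac)
  also have "\<dots> = (\<Sum>p\<in>N. g (fst p) (snd p) * (y (fst p) * y (snd p)))" by (simp add: case_prod_beta)
  also have "\<dots> \<le> (\<Sum>p\<in>N. \<bar>g (fst p) (snd p)\<bar> * \<bar>y (fst p) * y (snd p)\<bar>)"
    by (intro sum_mono) (metis abs_ge_self abs_mult)
  also have "\<dots> \<le> L2_set (\<lambda>p. g (fst p) (snd p)) N * L2_set (\<lambda>p. y (fst p) * y (snd p)) N"
    by (rule L2_set_mult_ineq)
  also have "L2_set (\<lambda>p. y (fst p) * y (snd p)) N = (\<Sum>j<n. (y j)\<^sup>2)"
  proof -
    have "(\<Sum>p\<in>N. (y (fst p) * y (snd p))\<^sup>2) = (\<Sum>j<n. (y j)\<^sup>2)\<^sup>2"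
      unfolding power2_eq_square[of "sum _ _"] sum_product
      by (simp add: N_def sum.cartesian_product case_prod_beta power_mult_distrib)
    then show ?thesis by (simp add: L2_set_def sum_nonneg)
  qed
  also have "L2_set (\<lambda>p. g (fst p) (snd p)) N * (\<Sum>j<n. (y j)\<^sup>2) \<le> sqrt (real m * real n * b ^ 3 * c) * (\<Sum>j<n. (y j)\<^sup>2)"
    using cyc unfolding L2_set_def
    by (intro mult_right_mono) (auto simp: case_prod_beta sum_nonneg)
  finally show ?thesis .
qed

text \<open>Each of the two rounds takes a fourth root, by
  \<open>cut_bound_imp_operator_bound\<close>, and a factor \<open>2 * q\<close>, by duality with
  both \<open>A\<close> and \<open>B\<close>. The first turns \<open>\<kappa>\<close> into the cut
  bound \<open>c\<close> for the product of \<open>M A B\<close> and \<open>d\<close>; the second,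
  with entries bounded by \<open>2 * L\<close>, gives the nested roots.\<close>

lemma square_weighted_sum_bound:
  fixes d :: "nat \<Rightarrow> nat \<Rightarrow> real"
  defines "M A B i j \<equiv> A $$ (i,j) - B $$ (i,j)"
  assumes A: "A \<in> carrier_mat m n" and B: "B \<in> carrier_mat m n"
    and nA: "nuclear_norm A \<le> q * sqrt (real m * real n)"
    and nB: "nuclear_norm B \<le> q * sqrt (real m * real n)"
    and q: "q \<ge> 0" and L: "L > 0" and \<kappa>: "\<kappa> \<ge> 0"
    and AL: "\<And>i j. i < m \<Longrightarrow> j < n \<Longrightarrow> \<bar>A $$ (i,j)\<bar> \<le> L"
    and BL: "\<And>i j. i < m \<Longrightarrow> j < n \<Longrightarrow> \<bar>B $$ (i,j)\<bar> \<le> L"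
    and d1: "\<And>i j. i < m \<Longrightarrow> j < n \<Longrightarrow> \<bar>d i j\<bar> \<le> 1"
    and cut: "\<And>x y. (\<And>i. i < m \<Longrightarrow> \<bar>x i\<bar> \<le> 1) \<Longrightarrow> (\<And>j. j < n \<Longrightarrow> \<bar>y j\<bar> \<le> 1) \<Longrightarrow>
        \<bar>\<Sum>i<m. \<Sum>j<n. x i * d i j * y j\<bar> \<le> real m * real n * \<kappa>"
  shows "\<bar>\<Sum>i<m. \<Sum>j<n. (A $$ (i,j) - B $$ (i,j))\<^sup>2 * d i j\<bar> \<le>
    real m * real n * (2 * q * sqrt (sqrt ((2 * L) ^ 3 * (2 * q * sqrt (sqrt \<kappa>)))))"
proof -
  define N where "N = real m * real n"
  have N: "N \<ge> 0" by (simp add: N_def)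
  \<comment> \<open>The hypothesis on \<open>w\<close> has the form of the operator bound above,
    with \<open>N * t\<close> for the cut bound times the cube of the entry bound. It says that
    \<open>w\<close> has operator norm at most \<open>K\<close>; the \<open>sqrt N\<close> in
    \<open>K\<close> and the one in the nuclear norm bounds multiply to \<open>N\<close>.\<close>
  have dual: "\<bar>\<Sum>i<m. \<Sum>j<n. M A B i j * w i j\<bar> \<le> N * (2 * q * sqrt (sqrt t))"
    if t: "t \<ge> 0" and w: "\<And>z. (\<Sum>i<m. (\<Sum>j<n. w i j * z j)\<^sup>2) \<le> sqrt (N * (N * t)) * (\<Sum>j<n. (z j)\<^sup>2)"
    for w t
  proof -
    define K where "K = sqrt N * sqrt (sqrt t)"
    have K: "K \<ge> 0" using N t by (simp add: K_def)
    have "K\<^sup>2 = sqrt (N * (N * t))"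
      using N t by (simp add: K_def power_mult_distrib real_sqrt_mult)
    then have w': "\<And>z. (\<Sum>i<m. (\<Sum>j<n. w i j * z j)\<^sup>2) \<le> K\<^sup>2 * (\<Sum>j<n. (z j)\<^sup>2)" using w by simp
    have "(\<Sum>i<m. \<Sum>j<n. M A B i j * w i j) =
        (\<Sum>i<m. \<Sum>j<n. A $$ (i,j) * w i j) - (\<Sum>i<m. \<Sum>j<n. B $$ (i,j) * w i j)"
      by (simp add: M_def left_diff_distrib sum_subtractf)
    then have "\<bar>\<Sum>i<m. \<Sum>j<n. M A B i j * w i j\<bar> \<le> K * nuclear_norm A + K * nuclear_norm B"
      using nuclear_norm_duality[OF A K w'] nuclear_norm_duality[OF B K w'] by linarith
    also have "\<dots> \<le> K * (q * sqrt N) + K * (q * sqrt N)"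
      using nA nB K unfolding N_def by (intro add_mono mult_left_mono)
    also have "\<dots> = N * (2 * q * sqrt (sqrt t))" using N by (simp add: K_def)
    finally show ?thesis .
  qed
  have M: "\<bar>M A B i j\<bar> \<le> 2 * L" if "i < m" "j < n" for i j
    using AL[OF that] BL[OF that] unfolding M_def by linarith
  define c where "c = 2 * q * sqrt (sqrt \<kappa>)"
  have c: "c \<ge> 0" using q \<kappa> by (simp add: c_def)
  have "\<bar>\<Sum>i<m. \<Sum>j<n. x i * (M A B i j * d i j) * y j\<bar> \<le> N * c"
    if x: "\<And>i. i < m \<Longrightarrow> \<bar>x i\<bar> \<le> 1" and y: "\<And>j. j < n \<Longrightarrow> \<bar>y j\<bar> \<le> 1" for x y
  proof -
    have "\<bar>\<Sum>i<m. \<Sum>j<n. M A B i j * (x i * d i j * y j)\<bar> \<le> N * c"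
      unfolding c_def
    proof (rule dual[OF \<kappa>])
      fix z :: "nat \<Rightarrow> real"
      \<comment> \<open>Scaling rows by \<open>x\<close> and columns by \<open>y\<close> does not
        increase the bound on the operator norm, as all factors are at most 1 in absolute value;
        \<open>y\<close> is absorbed into the vector \<open>z\<close>.\<close>
      have "(\<Sum>i<m. (\<Sum>j<n. x i * d i j * y j * z j)\<^sup>2) = (\<Sum>i<m. (x i)\<^sup>2 * (\<Sum>j<n. d i j * (y j * z j))\<^sup>2)"
        unfolding power_mult_distrib[symmetric] sum_distrib_left by (simp add: mult.assoc)
      also have "\<dots> \<le> (\<Sum>i<m. (\<Sum>j<n. d i j * (y j * z j))\<^sup>2)"
        using x by (intro sum_mono mult_left_le_one_le) (auto simp: abs_square_le_1)
      also have "\<dots> \<le> sqrt (real m * real n * 1 ^ 3 * (real m * real n * \<kappa>)) * (\<Sum>j<n. (y j * z j)\<^sup>2)"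
        by (rule cut_bound_imp_operator_bound) (simp, blast intro: d1, blast intro: cut)
      also have "\<dots> \<le> sqrt (N * (N * \<kappa>)) * (\<Sum>j<n. (z j)\<^sup>2)"
        using y N \<kappa> unfolding N_def[symmetric]
        by (intro mult_mono sum_mono) (auto simp: power_mult_distrib abs_square_le_1 intro!: mult_left_le_one_le sum_nonneg)
      finally show "(\<Sum>i<m. (\<Sum>j<n. x i * d i j * y j * z j)\<^sup>2) \<le> sqrt (N * (N * \<kappa>)) * (\<Sum>j<n. (z j)\<^sup>2)" .
    qed
    then show ?thesis by (simp add: mult_ac)
  qed
  \<comment> \<open>The second round starts here, from the cut bound just obtained.\<close>
  then have op: "(\<Sum>i<m. (\<Sum>j<n. M A B i j * d i j * z j)\<^sup>2) \<le>
      sqrt (real m * real n * (2 * L) ^ 3 * (N * c)) * (\<Sum>j<n. (z j)\<^sup>2)" for z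
    using L M d1 by (intro cut_bound_imp_operator_bound) (auto simp: abs_mult intro: order_trans[OF mult_left_le])
  have "\<bar>\<Sum>i<m. \<Sum>j<n. M A B i j * (M A B i j * d i j)\<bar> \<le> N * (2 * q * sqrt (sqrt ((2 * L) ^ 3 * c)))"
    using op L c by (intro dual) (auto simp: N_def mult_ac)
  then show ?thesis by (simp add: M_def N_def c_def power2_eq_square mult_ac)
qed

section \<open>Elementary properties of the cut norm, the cut distance and the max norm\<close>

lemma cut_norm_bound:
  assumes "dim_row D > 0" "dim_col D > 0"
    and "\<And>i. i < dim_row D \<Longrightarrow> \<bar>x i\<bar> \<le> 1" "\<And>j. j < dim_col D \<Longrightarrow> \<bar>y j\<bar> \<le> 1"
  shows "\<bar>\<Sum>i<dim_row D. \<Sum>j<dim_col D. x i * D $$ (i,j) * y j\<bar> \<le>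
    real (dim_row D) * real (dim_col D) * cut_norm D"
proof -
  let ?S = "{\<bar>\<Sum>i<dim_row D. \<Sum>j<dim_col D. x i * D $$ (i,j) * y j\<bar> | x y.
            (\<forall>i<dim_row D. \<bar>x i\<bar> \<le> 1) \<and> (\<forall>j<dim_col D. \<bar>y j\<bar> \<le> (1::real))}"
  \<comment> \<open>A real \<open>Sup\<close> is an upper bound only for sets that are bounded
    above; the sum of the absolute values of the entries of \<open>D\<close> is a bound
    here.\<close>
  have "bdd_above ?S"
  proof (rule bdd_aboveI)
    fix s assume "s \<in> ?S"
    then obtain x y where s: "s = \<bar>\<Sum>i<dim_row D. \<Sum>j<dim_col D. x i * D $$ (i,j) * y j\<bar>"
      and xy: "\<forall>i<dim_row D. \<bar>x i\<bar> \<le> 1" "\<forall>j<dim_col D. \<bar>y j\<bar> \<le> (1::real)" by auto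
    have "s \<le> (\<Sum>i<dim_row D. \<Sum>j<dim_col D. \<bar>x i * D $$ (i,j) * y j\<bar>)"
      unfolding s by (intro order_trans[OF sum_abs] sum_mono sum_abs)
    also have "\<dots> \<le> (\<Sum>i<dim_row D. \<Sum>j<dim_col D. 1 * \<bar>D $$ (i,j)\<bar> * 1)"
      unfolding abs_mult using xy by (intro sum_mono mult_mono) auto
    finally show "s \<le> (\<Sum>i<dim_row D. \<Sum>j<dim_col D. 1 * \<bar>D $$ (i,j)\<bar> * 1)" .
  qed
  then have "\<bar>\<Sum>i<dim_row D. \<Sum>j<dim_col D. x i * D $$ (i,j) * y j\<bar> \<le> Sup ?S"
    using assms by (intro cSup_upper) auto
  then show ?thesis using assms by (simp add: cut_norm_def)
qed

lemma cut_dist_attained: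
  obtains \<pi> \<tau> where "\<pi> permutes {..<dim_row A}" "\<tau> permutes {..<dim_col A}"
    "cut_dist A B = cut_norm (perm_mat A \<pi> \<tau> - B)"
proof -
  let ?S = "{cut_norm (perm_mat A \<pi> \<tau> - B) | \<pi> \<tau>.
       \<pi> permutes {..<dim_row A} \<and> \<tau> permutes {..<dim_col A}}"
  have "?S = (\<lambda>(\<pi>,\<tau>). cut_norm (perm_mat A \<pi> \<tau> - B)) `
      ({\<pi>. \<pi> permutes {..<dim_row A}} \<times> {\<tau>. \<tau> permutes {..<dim_col A}})" by auto
  then have "finite ?S" by (simp add: finite_permutations)
  moreover have "?S \<noteq> {}" using permutes_id by blast
  ultimately have "Min ?S \<in> ?S" by (rule Min_in)
  then show thesis using that unfolding cut_dist_def by blast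
qed

lemma abs_le_max_norm:
  assumes "i < dim_row A" "j < dim_col A"
  shows "\<bar>A $$ (i,j)\<bar> \<le> max_norm A"
proof -
  have "{\<bar>A $$ (i,j)\<bar> | i j. i < dim_row A \<and> j < dim_col A} =
      (\<lambda>(i,j). \<bar>A $$ (i,j)\<bar>) ` ({..<dim_row A} \<times> {..<dim_col A})" by auto
  then have "finite {\<bar>A $$ (i,j)\<bar> | i j. i < dim_row A \<and> j < dim_col A}" by simp
  then show ?thesis unfolding max_norm_def using assms by (intro Max_ge) auto
qed

section \<open>Small entries of the graphon matrix\<close>

lemma measure_lborel_Times:
  fixes A B :: "real set"
  assumes "A \<in> sets borel" "B \<in> sets borel"
  shows "measure lborel (A \<times> B) = measure lborel A * measure lborel B"
  using lborel.emeasure_pair_measure_Times[of A lborel B] assms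
  by (simp add: lborel_prod measure_def enn2real_mult)

text \<open>Half-open, hence disjoint, unlike the closed rectangles of \<^const>\<open>graphon_mat\<close>.\<close>

definition grid_cell :: "nat \<Rightarrow> nat \<Rightarrow> nat \<times> nat \<Rightarrow> (real \<times> real) set" where
  "grid_cell m n p = {real (fst p) / real m ..< real (Suc (fst p)) / real m} \<times>
    {real (snd p) / real n ..< real (Suc (snd p)) / real n}"

lemma grid_cell_sets [measurable]: "grid_cell m n p \<in> sets borel"
  unfolding grid_cell_def by (rule borel_Times) auto

lemma measure_grid_cell:
  assumes "m > 0" "n > 0"
  shows "measure lborel (grid_cell m n p) = 1 / (real m * real n)"
  using assms by (simp add: grid_cell_def measure_lborel_Times divide_right_mono diff_divide_distrib[symmetric])

lemma grid_cell_subset: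
  assumes "i < m" "j < n"
  shows "{real i / real m .. real (Suc i) / real m} \<times> {real j / real n .. real (Suc j) / real n}
    \<subseteq> {0..1} \<times> {0..1}"
proof -
  have "0 \<le> real i / real m" "0 \<le> real j / real n" "real (Suc i) / real m \<le> 1" "real (Suc j) / real n \<le> 1"
    using assms by (auto simp: divide_le_eq_1)
  then show ?thesis
    by (simp only: subset_iff mem_Times_iff atLeastAtMost_iff) (meson order_trans)
qed

text \<open>The index of a cell is recovered from any of its points as the floors of the coordinates
  scaled by \<open>m\<close> and \<open>n\<close>.\<close>

lemma disjoint_grid_cell:
  assumes "m > 0" "n > 0"
  shows "disjoint_family (grid_cell m n)"
proof -
  have eq: "i = \<lfloor>x * real m\<rfloor>" if "m > 0" "real_of_int i / real m \<le> x" "x < (real_of_int i + 1) / real m"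
    for i :: int and x m
    using that by (intro floor_unique[symmetric]) (auto simp: field_simps)
  have "p = p'" if "z \<in> grid_cell m n p" "z \<in> grid_cell m n p'" for z p p'
  proof -
    have "int (fst p) = \<lfloor>fst z * real m\<rfloor>" "int (fst p') = \<lfloor>fst z * real m\<rfloor>"
      "int (snd p) = \<lfloor>snd z * real n\<rfloor>" "int (snd p') = \<lfloor>snd z * real n\<rfloor>"
      using that assms by (auto intro!: eq simp: grid_cell_def add_ac)
    then show ?thesis by (simp add: prod_eq_iff)
  qed
  then show ?thesis unfolding disjoint_family_on_def by blast
qed

section \<open>Sublevel sets of the graphon\<close>

context
  fixes W :: "real \<times> real \<Rightarrow> real"
  assumes W: "graphon W"
begin

text \<open>The restriction to the unit square keeps the measure finite and avoids the arbitrary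
  values of \<open>W\<close> outside.\<close>

definition sublevel :: "real \<Rightarrow> (real \<times> real) set" where
  "sublevel c = {z \<in> {0..1} \<times> {0..1}. W z < c}"

text \<open>Extension by zero makes \<open>W\<close> Borel on the whole plane, whereas
  \<open>graphon\<close> gives measurability on the square only.\<close>

lemma graphon_indicator_measurable [measurable]:
  "(\<lambda>z. indicat_real ({0..1} \<times> {0..1}) z * W z) \<in> borel_measurable borel"
proof -
  have "({0..1} \<times> {0..1} :: (real \<times> real) set) \<in> sets borel" by (rule borel_Times) auto
  then show ?thesis using W unfolding graphon_def
    by (subst (asm) borel_measurable_restrict_space_iff) auto
qed

lemma sublevel_sets [measurable]: "sublevel c \<in> sets borel"
proof -
  have [measurable]: "({0..1} \<times> {0..1} :: (real \<times> real) set) \<in> sets borel" by (rule borel_Times) auto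
  have "sublevel c = {z \<in> space borel. z \<in> {0..1} \<times> {0..1} \<and> indicat_real ({0..1} \<times> {0..1}) z * W z < c}"
    by (auto simp: sublevel_def)
  also have "\<dots> \<in> sets borel" by measurable
  finally show ?thesis .
qed

lemma emeasure_unit_square: "emeasure lborel ({0..1} \<times> {0..1} :: (real \<times> real) set) = 1"
  using lborel.emeasure_pair_measure_Times[of "{0..1::real}" lborel "{0..1::real}"] by (simp add: lborel_prod)

lemma fmeasurable_sublevel: "sublevel c \<in> fmeasurable lborel"
proof (rule fmeasurableI2)
  show "{0..1} \<times> {0..1} \<in> fmeasurable (lborel :: (real \<times> real) measure)"
    by (intro fmeasurableI) (auto simp: emeasure_unit_square intro: borel_Times)
  show "sublevel c \<subseteq> {0..1} \<times> {0..1}" by (auto simp: sublevel_def)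
qed simp

text \<open>The sublevel sets at \<open>1 / real (Suc k)\<close> decrease to the zero set of
  \<open>W\<close>, which is null, and have finite measure. So continuity from above
  applies.\<close>

lemma measure_sublevel_small:
  assumes nz: "AE z in lborel. z \<in> {0..1} \<times> {0..1} \<longrightarrow> W z \<noteq> 0" and "\<eta> > 0"
  shows "\<exists>c>0. measure lborel (sublevel c) \<le> \<eta>"
proof -
  let ?E = "\<lambda>k::nat. sublevel (1 / real (Suc k))"
  have "(\<lambda>k. measure lborel (?E k)) \<longlonglongrightarrow> measure lborel (\<Inter>k. ?E k)"
  proof (rule Lim_measure_decseq)
    show "range ?E \<subseteq> sets lborel" by auto
    show "decseq ?E"
      unfolding sublevel_def
      by (intro decseq_SucI) (auto intro: less_le_trans simp: frac_le)
    show "emeasure lborel (?E k) \<noteq> \<infinity>" for k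
      using fmeasurableD2[OF fmeasurable_sublevel] by auto
  qed
  moreover have "measure lborel (\<Inter>k. ?E k) = 0"
  proof -
    have "W z = 0" if "z \<in> (\<Inter>k. ?E k)" for z
    proof (rule antisym)
      show "W z \<le> 0"
      proof (rule ccontr)
        assume "\<not> ?thesis"
        then obtain k where "1 / real (Suc k) < W z"
          using nat_approx_posE[of "W z"] by auto
        moreover have "z \<in> ?E k" using that by blast
        ultimately show False by (simp add: sublevel_def)
      qed
      show "0 \<le> W z" using W that by (auto simp: sublevel_def graphon_def)
    qed
    then have "AE z in lborel. z \<notin> (\<Inter>k. ?E k)"
      using nz by (auto elim!: eventually_mono simp: sublevel_def)
    then have "emeasure lborel (\<Inter>k. ?E k) = 0"
      by (subst (asm) AE_iff_measurable[where N="\<Inter>k. ?E k"]) auto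
    then show ?thesis by (simp add: measure_def)
  qed
  ultimately have "\<forall>\<^sub>F k in sequentially. measure lborel (?E k) < \<eta>"
    using \<open>\<eta> > 0\<close> by (auto intro: order_tendstoD)
  then obtain k where "measure lborel (?E k) < \<eta>" by (auto simp: eventually_sequentially)
  then show ?thesis by (intro exI[of _ "1 / real (Suc k)"]) auto
qed

text \<open>The entry is the average of \<open>W\<close> over its cell. For the third claim,
  Markov's inequality shows that an average below \<open>c / 2\<close> leaves less than half of the
  cell to values of at least \<open>c\<close>.\<close>

lemma graphon_mat_entry:
  assumes ij: "i < m" "j < n"
  shows "0 \<le> graphon_mat W m n $$ (i,j)" "graphon_mat W m n $$ (i,j) \<le> 1"
    and "c > 0 \<Longrightarrow> graphon_mat W m n $$ (i,j) < c / 2 \<Longrightarrow>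
      1 / (2 * real m * real n) \<le> measure lborel (grid_cell m n (i,j) \<inter> sublevel c)"
proof -
  define C where "C = {real i / real m .. real (Suc i) / real m} \<times> {real j / real n .. real (Suc j) / real n}"
  define N where "N = real m * real n"
  have N: "N > 0" using ij by (simp add: N_def)
  have C: "C \<in> sets borel" unfolding C_def by (rule borel_Times) auto
  have sq: "C \<subseteq> {0..1} \<times> {0..1}" unfolding C_def using grid_cell_subset[OF ij] .
  have QC: "grid_cell m n (i,j) \<subseteq> C" unfolding C_def grid_cell_def by auto
  have mC: "measure lborel C = 1 / N"
    using ij unfolding C_def
    by (subst measure_lborel_Times) (auto simp: N_def divide_right_mono diff_divide_distrib[symmetric])
  have fC: "C \<in> fmeasurable lborel"
    using C N mC by (intro fmeasurableI) (auto simp: measure_def top.not_eq_extremum[symmetric])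
  have int: "integrable lborel (indicat_real C)"
    using fC by (simp add: fmeasurable_def)
  have eqW: "indicat_real C z * W z = indicat_real C z * (indicat_real ({0..1} \<times> {0..1}) z * W z)" for z
    using sq by (auto simp: indicator_def)
  have W01: "0 \<le> indicat_real C z * W z" "indicat_real C z * W z \<le> indicat_real C z" for z
    using W sq by (auto simp: indicator_def graphon_def)
  have meas: "(\<lambda>z. indicat_real C z * W z) \<in> borel_measurable lborel"
    unfolding eqW using C by measurable
  have intW: "integrable lborel (\<lambda>z. indicat_real C z * W z)"
    using W01 by (intro Bochner_Integration.integrable_bound[OF int meas]) (auto simp: abs_of_nonneg)
  have e: "graphon_mat W m n $$ (i,j) = N * (LINT z|lborel. indicat_real C z * W z)"
    using ij by (simp add: graphon_mat_def C_def N_def set_lebesgue_integral_def)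
  show "0 \<le> graphon_mat W m n $$ (i,j)"
    unfolding e using N W01 by (intro mult_nonneg_nonneg integral_nonneg_AE) auto
  have "(LINT z|lborel. indicat_real C z * W z) \<le> (LINT z|lborel. indicat_real C z)"
    using W01 by (intro integral_mono intW int)
  then show "graphon_mat W m n $$ (i,j) \<le> 1"
    unfolding e using N C mC by (simp add: field_simps)
  assume c: "c > 0" and small: "graphon_mat W m n $$ (i,j) < c / 2"
  let ?Q = "grid_cell m n (i,j)"
  have fQ: "?Q \<in> fmeasurable lborel" using fmeasurableI2[OF fC QC] by simp
  have fQE: "?Q - sublevel c \<in> fmeasurable lborel" by (rule fmeasurable_Diff[OF fQ]) simp
  \<comment> \<open>\<open>W\<close> is at least \<open>c\<close> on this part of the half-open
    cell, and passing to the closed rectangle \<open>C\<close> only adds nonnegative values.\<close>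
  have "c * measure lborel (?Q - sublevel c) = (LINT z|lborel. c * indicat_real (?Q - sublevel c) z)"
    by simp
  also have "\<dots> \<le> (LINT z|lborel. indicat_real C z * W z)"
  proof (rule integral_mono[OF _ intW])
    show "integrable lborel (\<lambda>z. c * indicat_real (?Q - sublevel c) z)"
      using fQE by (simp add: fmeasurable_def)
    show "c * indicat_real (?Q - sublevel c) z \<le> indicat_real C z * W z" for z
      using QC sq W01(1)[of z] by (auto simp: indicator_def sublevel_def)
  qed
  finally have "c * (N * measure lborel (?Q - sublevel c)) \<le> N * (LINT z|lborel. indicat_real C z * W z)"
    using N by (simp add: mult.left_commute)
  then have "c * (N * measure lborel (?Q - sublevel c)) < c * (1 / 2)" using small e by simp
  then have "N * measure lborel (?Q - sublevel c) < 1 / 2" using c by (simp only: mult_less_cancel_left_pos)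
  moreover have "measure lborel (?Q - sublevel c) = measure lborel ?Q - measure lborel (?Q \<inter> sublevel c)"
    using measure_Diff[of lborel ?Q "?Q \<inter> sublevel c"] fmeasurableD2[OF fQ] by (simp add: Diff_Int2 Diff_Int)
  moreover have "measure lborel ?Q = 1 / N" using measure_grid_cell[of m n "(i,j)"] ij by (simp add: N_def)
  ultimately have "1 / 2 \<le> N * measure lborel (?Q \<inter> sublevel c)" using N by (simp add: algebra_simps)
  then show "1 / (2 * real m * real n) \<le> measure lborel (?Q \<inter> sublevel c)"
    using N by (simp add: N_def field_simps)
qed

text \<open>Each small entry accounts for measure at least \<open>1 / (2 * m * n)\<close> of the
  sublevel set inside its own cell, and the cells are disjoint.\<close>

lemma number_small_entries:
  assumes mn: "m > 0" "n > 0" and c: "c > 0"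
  shows "(\<Sum>i<m. \<Sum>j<n. of_bool (graphon_mat W m n $$ (i,j) < c / 2)) \<le>
    2 * (real m * real n) * measure lborel (sublevel c)"
proof -
  define N where "N = real m * real n"
  have N: "N > 0" using mn by (simp add: N_def)
  define F where "F = {p \<in> {..<m} \<times> {..<n}. graphon_mat W m n $$ p < c / 2}"
  have F: "finite F" by (simp add: F_def)
  have "(\<Sum>i<m. \<Sum>j<n. of_bool (graphon_mat W m n $$ (i,j) < c / 2)) =
      (\<Sum>p\<in>{..<m} \<times> {..<n}. of_bool (graphon_mat W m n $$ p < c / 2) :: real)"
    unfolding sum.cartesian_product by (intro sum.cong) auto
  also have "\<dots> = (\<Sum>p\<in>F. 1)" unfolding F_def by (subst sum.inter_filter) (auto simp: of_bool_def)
  also have "\<dots> \<le> (\<Sum>p\<in>F. 2 * N * measure lborel (grid_cell m n p \<inter> sublevel c))"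
  proof (rule sum_mono)
    fix p assume "p \<in> F"
    then have "1 / (2 * real m * real n) \<le> measure lborel (grid_cell m n p \<inter> sublevel c)"
      using graphon_mat_entry(3)[OF _ _ c, of "fst p" m "snd p" n] by (auto simp: F_def)
    then show "1 \<le> 2 * N * measure lborel (grid_cell m n p \<inter> sublevel c)"
      using N by (simp add: N_def field_simps)
  qed
  also have "\<dots> = 2 * N * (\<Sum>p\<in>F. measure lborel (grid_cell m n p \<inter> sublevel c))"
    by (simp add: sum_distrib_left)
  also have "(\<Sum>p\<in>F. measure lborel (grid_cell m n p \<inter> sublevel c)) =
      measure lborel (\<Union>p\<in>F. grid_cell m n p \<inter> sublevel c)"
  proof (rule measure_finite_Union[symmetric, OF F])
    show "(\<lambda>p. grid_cell m n p \<inter> sublevel c) ` F \<subseteq> sets lborel" by auto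
    show "disjoint_family_on (\<lambda>p. grid_cell m n p \<inter> sublevel c) F"
      using disjoint_grid_cell[OF mn] unfolding disjoint_family_on_def by blast
    show "emeasure lborel (grid_cell m n p \<inter> sublevel c) \<noteq> \<infinity>" for p
    proof -
      have "grid_cell m n p \<inter> sublevel c \<in> fmeasurable lborel"
        by (rule fmeasurableI2[OF fmeasurable_sublevel[of c]]) auto
      then show ?thesis by (auto dest: fmeasurableD2)
    qed
  qed
  also have "2 * N * measure lborel (\<Union>p\<in>F. grid_cell m n p \<inter> sublevel c) \<le>
      2 * N * measure lborel (sublevel c)"
    by (intro mult_left_mono measure_mono_fmeasurable[OF _ _ fmeasurable_sublevel]) (use F N in auto)
  finally show ?thesis unfolding N_def .
qed

end

section \<open>Recovery\<close>

lemma sum_permutes2: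
  fixes f :: "nat \<Rightarrow> nat \<Rightarrow> real"
  assumes "\<pi> permutes {..<m}" "\<tau> permutes {..<n}"
  shows "(\<Sum>i<m. \<Sum>j<n. f i j) = (\<Sum>i<m. \<Sum>j<n. f (\<pi> i) (\<tau> j))"
proof -
  have "(\<Sum>i<m. \<Sum>j<n. f i j) = (\<Sum>i<m. \<Sum>j<n. f (\<pi> i) j)"
    by (subst sum.permute[OF assms(1)]) (simp add: o_def)
  also have "\<dots> = (\<Sum>i<m. \<Sum>j<n. f (\<pi> i) (\<tau> j))"
    by (subst sum.permute[OF assms(2)]) (simp add: o_def)
  finally show ?thesis .
qed

lemma nfrob_norm_square:
  assumes "A \<in> carrier_mat m n"
  shows "(nfrob_norm A)\<^sup>2 = (\<Sum>i<m. \<Sum>j<n. (A $$ (i,j))\<^sup>2) / (real m * real n)"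
  using assms by (simp add: nfrob_norm_def sum_nonneg)

text \<open>The bound for a single size. Where the permuted graphon matrix \<open>w\<close> is at
  least \<open>c / 2\<close>, the square of \<open>M\<close> is at most \<open>2 / c\<close> times
  its \<open>w\<close>-weighted value, and \<open>w = P - d\<close> splits this into the observed
  norm and the error term. The other entries number at most \<open>2 * N * \<mu>\<close> and
  contribute at most \<open>4 * L\<^sup>2\<close> each.\<close>

lemma nfrob_norm_recovery:
  fixes A B P :: "real mat"
  assumes mn: "m > 0" "n > 0"
    and A: "A \<in> carrier_mat m n" and B: "B \<in> carrier_mat m n" and P: "P \<in> carrier_mat m n"
    and bin: "binary_mat P" and W: "graphon W"
    and nA: "nuclear_norm A \<le> q * sqrt (real m * real n)"
    and nB: "nuclear_norm B \<le> q * sqrt (real m * real n)"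
    and q: "q \<ge> 0" and L: "L > 0" and c: "c > 0"
    and AL: "max_norm A \<le> L" and BL: "max_norm B \<le> L"
  shows "(nfrob_norm (A - B))\<^sup>2 \<le> 2 / c * ((nfrob_norm ((A - B) \<circ>\<^sub>H P))\<^sup>2 +
      2 * q * sqrt (sqrt ((2 * L) ^ 3 * (2 * q * sqrt (sqrt (cut_dist_graphon P W)))))) +
    8 * L\<^sup>2 * measure lborel (sublevel W c)"
proof -
  define G where "G = graphon_mat W m n"
  define N where "N = real m * real n"
  define \<kappa> where "\<kappa> = cut_dist_graphon P W"
  define \<mu> where "\<mu> = measure lborel (sublevel W c)"
  define er where "er = 2 * q * sqrt (sqrt ((2 * L) ^ 3 * (2 * q * sqrt (sqrt \<kappa>))))"
  have N: "N > 0" using mn by (simp add: N_def)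
  have G: "G \<in> carrier_mat m n" by (simp add: G_def graphon_mat_def)
  obtain \<pi> \<tau> where \<pi>: "\<pi> permutes {..<m}" and \<tau>: "\<tau> permutes {..<n}"
    and cd: "\<kappa> = cut_norm (perm_mat P \<pi> \<tau> - G)"
    using cut_dist_attained[of P G] P unfolding \<kappa>_def cut_dist_graphon_def G_def by auto
  \<comment> \<open>The optimal permutations act on \<open>P\<close>. Their inverses are applied to
    the graphon matrix instead, so that \<open>P\<close> stays aligned with \<open>A\<close> and
    \<open>B\<close>.\<close>
  define w where "w i j = G $$ (inv_into UNIV \<pi> i, inv_into UNIV \<tau> j)" for i j
  define d where "d i j = P $$ (i,j) - w i j" for i j
  define M where "M i j = A $$ (i,j) - B $$ (i,j)" for i j
  have w\<pi>: "w (\<pi> i) (\<tau> j) = G $$ (i,j)" for i j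
    using permutes_inverses(2)[OF \<pi>] permutes_inverses(2)[OF \<tau>] by (simp add: w_def)
  have inv_lt: "inv_into UNIV \<pi> i < m" "inv_into UNIV \<tau> j < n" if "i < m" "j < n" for i j
    using permutes_in_image[OF permutes_inv[OF \<pi>], of i] permutes_in_image[OF permutes_inv[OF \<tau>], of j] that by auto
  have im: "\<pi> i < m" if "i < m" for i using permutes_in_image[OF \<pi>, of i] that by auto
  have jm: "\<tau> j < n" if "j < n" for j using permutes_in_image[OF \<tau>, of j] that by auto
  have w01: "0 \<le> w i j" "w i j \<le> 1" if "i < m" "j < n" for i j
    using graphon_mat_entry(1,2)[OF W inv_lt[OF that]] by (auto simp: w_def G_def)
  have P01: "P $$ (i,j) = 0 \<or> P $$ (i,j) = 1" if "i < m" "j < n" for i j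
    using bin P that by (auto simp: binary_mat_def)
  have d1: "\<bar>d i j\<bar> \<le> 1" if "i < m" "j < n" for i j
    using w01[OF that] P01[OF that] by (auto simp: d_def)
  have cut: "\<bar>\<Sum>i<m. \<Sum>j<n. x i * d i j * y j\<bar> \<le> N * \<kappa>"
    if x: "\<And>i. i < m \<Longrightarrow> \<bar>x i\<bar> \<le> 1" and y: "\<And>j. j < n \<Longrightarrow> \<bar>y j\<bar> \<le> 1" for x y
  proof -
    define D where "D = perm_mat P \<pi> \<tau> - G"
    have D: "dim_row D = m" "dim_col D = n" using G by (auto simp: D_def)
    have "(\<Sum>i<m. \<Sum>j<n. x i * d i j * y j) = (\<Sum>i<m. \<Sum>j<n. x (\<pi> i) * d (\<pi> i) (\<tau> j) * y (\<tau> j))"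
      by (rule sum_permutes2[OF \<pi> \<tau>])
    also have "\<dots> = (\<Sum>i<m. \<Sum>j<n. x (\<pi> i) * D $$ (i,j) * y (\<tau> j))"
      using P G by (intro sum.cong refl) (auto simp: d_def w\<pi> D_def perm_mat_def)
    finally show ?thesis
      using cut_norm_bound[of D "\<lambda>i. x (\<pi> i)" "\<lambda>j. y (\<tau> j)"] mn x y im jm
      unfolding D N_def cd D_def[symmetric] by auto
  qed
  have "0 \<le> N * \<kappa>" using cut[of "\<lambda>_. 0" "\<lambda>_. 0"] by simp
  then have \<kappa>: "\<kappa> \<ge> 0" using N by (simp add: zero_le_mult_iff)
  have AL': "\<bar>A $$ (i,j)\<bar> \<le> L" "\<bar>B $$ (i,j)\<bar> \<le> L" if "i < m" "j < n" for i j
    using order_trans[OF abs_le_max_norm AL] order_trans[OF abs_le_max_norm BL] A B that by auto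
  have main: "\<bar>\<Sum>i<m. \<Sum>j<n. (M i j)\<^sup>2 * d i j\<bar> \<le> N * er"
    unfolding M_def N_def er_def
    by (rule square_weighted_sum_bound[OF A B nA nB q L \<kappa> AL' d1 cut[unfolded N_def]])
  have M2: "(M i j)\<^sup>2 \<le> 4 * L\<^sup>2" if "i < m" "j < n" for i j
  proof -
    have "\<bar>M i j\<bar> \<le> 2 * L" using AL'[OF that] unfolding M_def by linarith
    then have "\<bar>M i j\<bar>\<^sup>2 \<le> (2 * L)\<^sup>2" by (intro power_mono) auto
    then show ?thesis by (simp add: power_mult_distrib)
  qed
  have "(\<Sum>i<m. \<Sum>j<n. (M i j)\<^sup>2) \<le>
      (\<Sum>i<m. \<Sum>j<n. 2 / c * ((M i j)\<^sup>2 * w i j) + 4 * L\<^sup>2 * of_bool (w i j < c / 2))"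
  proof (intro sum_mono)
    fix i j assume "i \<in> {..<m}" "j \<in> {..<n}"
    then have ij: "i < m" "j < n" by auto
    show "(M i j)\<^sup>2 \<le> 2 / c * ((M i j)\<^sup>2 * w i j) + 4 * L\<^sup>2 * of_bool (w i j < c / 2)"
    proof (cases "w i j < c / 2")
      case True
      then show ?thesis using M2[OF ij] w01[OF ij] c by (simp add: add_increasing)
    next
      case False
      then have "(M i j)\<^sup>2 * 1 \<le> (M i j)\<^sup>2 * (2 / c * w i j)"
        using c by (intro mult_left_mono) (auto simp: field_simps)
      then show ?thesis using False by (simp add: mult_ac)
    qed
  qed
  also have "\<dots> = 2 / c * (\<Sum>i<m. \<Sum>j<n. (M i j)\<^sup>2 * w i j) +
      4 * L\<^sup>2 * (\<Sum>i<m. \<Sum>j<n. of_bool (w i j < c / 2))"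
    by (simp only: sum.distrib sum_distrib_left)
  \<comment> \<open>Permuting rows and columns does not change the number of small entries.\<close>
  also have "(\<Sum>i<m. \<Sum>j<n. of_bool (w i j < c / 2)) =
      (\<Sum>i<m. \<Sum>j<n. of_bool (G $$ (i,j) < c / 2) :: real)"
    by (subst sum_permutes2[OF \<pi> \<tau>]) (simp only: w\<pi>)
  also have "(\<Sum>i<m. \<Sum>j<n. (M i j)\<^sup>2 * w i j) =
      (\<Sum>i<m. \<Sum>j<n. (M i j)\<^sup>2 * P $$ (i,j)) - (\<Sum>i<m. \<Sum>j<n. (M i j)\<^sup>2 * d i j)"
    by (simp add: d_def right_diff_distrib sum_subtractf)
  also have "2 / c * \<dots> + 4 * L\<^sup>2 * (\<Sum>i<m. \<Sum>j<n. of_bool (G $$ (i,j) < c / 2)) \<le>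
      2 / c * ((\<Sum>i<m. \<Sum>j<n. (M i j)\<^sup>2 * P $$ (i,j)) + N * er) + 4 * L\<^sup>2 * (2 * N * \<mu>)"
    using main c number_small_entries[OF W mn c]
    by (intro add_mono mult_left_mono) (auto simp: G_def N_def \<mu>_def)
  finally have "(\<Sum>i<m. \<Sum>j<n. (M i j)\<^sup>2) \<le>
      2 / c * ((\<Sum>i<m. \<Sum>j<n. (M i j)\<^sup>2 * P $$ (i,j)) + N * er) + 4 * L\<^sup>2 * (2 * N * \<mu>)" .
  moreover have "(\<Sum>i<m. \<Sum>j<n. (M i j)\<^sup>2) = N * (nfrob_norm (A - B))\<^sup>2"
    using nfrob_norm_square[OF minus_carrier_mat[OF B], of A] N A B by (simp add: N_def M_def)
  moreover have "(\<Sum>i<m. \<Sum>j<n. (M i j)\<^sup>2 * P $$ (i,j)) = N * (nfrob_norm ((A - B) \<circ>\<^sub>H P))\<^sup>2"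
  proof -
    have H: "(A - B) \<circ>\<^sub>H P \<in> carrier_mat m n" using A B by (simp add: hadamard_def)
    have "(\<Sum>i<m. \<Sum>j<n. (M i j)\<^sup>2 * P $$ (i,j)) = (\<Sum>i<m. \<Sum>j<n. (((A - B) \<circ>\<^sub>H P) $$ (i,j))\<^sup>2)"
    proof (intro sum.cong refl)
      fix i j assume "i \<in> {..<m}" "j \<in> {..<n}"
      then have ij: "i < m" "j < n" by auto
      \<comment> \<open>The entries of \<open>P\<close> are 0 or 1 and hence equal to their
        squares.\<close>
      show "(M i j)\<^sup>2 * P $$ (i,j) = (((A - B) \<circ>\<^sub>H P) $$ (i,j))\<^sup>2"
        using P01[OF ij] ij A B by (auto simp: hadamard_def M_def)
    qed
    then show ?thesis using nfrob_norm_square[OF H] N by (simp add: N_def)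
  qed
  ultimately have "N * (nfrob_norm (A - B))\<^sup>2 \<le>
      N * (2 / c * ((nfrob_norm ((A - B) \<circ>\<^sub>H P))\<^sup>2 + er) + 8 * L\<^sup>2 * \<mu>)"
    by (simp add: algebra_simps)
  then show ?thesis using N unfolding er_def \<kappa>_def \<mu>_def by simp
qed

section \<open>Choice of constants and passage to the limit\<close>

theorem theorem8p1:
  fixes P :: "nat \<Rightarrow> real mat" and m n :: "nat \<Rightarrow> nat"
    and W :: "real \<times> real \<Rightarrow> real"
  assumes dimP: "\<And>k. dim_row (P k) = m k \<and> dim_col (P k) = n k"
    and binP: "\<And>k. binary_mat (P k)"
    and m_inf: "filterlim m at_top sequentially"
    and n_inf: "filterlim n at_top sequentially"
    and W: "graphon W"
    and W_nz: "AE z in lborel. z \<in> {0..1} \<times> {0..1} \<longrightarrow> W z \<noteq> 0"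
    and conv: "(\<lambda>k. cut_dist_graphon (P k) W) \<longlonglongrightarrow> 0"
  shows "\<forall>\<epsilon>>0. \<forall>q L::real. \<exists>\<delta>>0.
     \<forall>A B :: nat \<Rightarrow> real mat.
       (\<forall>k. dim_row (A k) = m k \<and> dim_col (A k) = n k \<and>
            dim_row (B k) = m k \<and> dim_col (B k) = n k \<and>
            nuclear_norm (A k) \<le> q * sqrt (real (m k) * real (n k)) \<and>
            nuclear_norm (B k) \<le> q * sqrt (real (m k) * real (n k)) \<and>
            max_norm (A k) \<le> L \<and> max_norm (B k) \<le> L) \<longrightarrow>
       limsup (\<lambda>k. ereal (nfrob_norm ((A k - B k) \<circ>\<^sub>H P k))) \<le> ereal \<delta> \<longrightarrow>
       limsup (\<lambda>k. ereal (nfrob_norm (A k - B k))) \<le> ereal \<epsilon>"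
proof (intro allI impI)
  fix \<epsilon> q L :: real assume \<epsilon>: "0 < \<epsilon>"
  \<comment> \<open>\<open>q\<close> and \<open>L\<close> are arbitrary reals; enlarging them
    provides the signs that \<open>nfrob_norm_recovery\<close> requires.\<close>
  define q' where "q' = max q 0"
  define L' where "L' = max L 1"
  have q': "q' \<ge> 0" "q \<le> q'" and L': "L' > 0" "L \<le> L'" by (auto simp: q'_def L'_def)
  \<comment> \<open>The level \<open>c\<close> is chosen so that the small entries contribute at
    most half of \<open>\<epsilon>\<^sup>2\<close>.\<close>
  have "\<epsilon>\<^sup>2 / (16 * L'\<^sup>2) > 0" using \<epsilon> L' by simp
  from measure_sublevel_small[OF W W_nz this] obtain c where c: "c > 0"
    and \<mu>: "measure lborel (sublevel W c) \<le> \<epsilon>\<^sup>2 / (16 * L'\<^sup>2)" by blast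
  \<comment> \<open>Eventually the observed norm is below \<open>2 * \<delta>\<close> and the error
    term below \<open>\<delta>\<^sup>2\<close>. Their contribution is then at most
    \<open>2 / c * (5 * \<delta>\<^sup>2)\<close>, which is the other half of
    \<open>\<epsilon>\<^sup>2\<close>.\<close>
  define \<delta> where "\<delta> = \<epsilon> * sqrt (c / 20)"
  have \<delta>: "\<delta> > 0" using \<epsilon> c by (simp add: \<delta>_def)
  have \<delta>2: "\<delta>\<^sup>2 = \<epsilon>\<^sup>2 * c / 20" using c by (simp add: \<delta>_def power_mult_distrib)
  \<comment> \<open>This error term does not involve \<open>A\<close> and \<open>B\<close>; it
    vanishes in the limit by continuity of the root.\<close>
  define er where "er k = 2 * q' * sqrt (sqrt ((2 * L') ^ 3 * (2 * q' * sqrt (sqrt (cut_dist_graphon (P k) W)))))" for k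
  have "er \<longlonglongrightarrow> 2 * q' * sqrt (sqrt ((2 * L') ^ 3 * (2 * q' * sqrt (sqrt 0))))"
    unfolding er_def by (intro tendsto_intros conv)
  then have "er \<longlonglongrightarrow> 0" by simp
  then have ev_er: "\<forall>\<^sub>F k in sequentially. er k < \<delta>\<^sup>2" using \<delta> by (auto intro: order_tendstoD)
  have ev_mn: "\<forall>\<^sub>F k in sequentially. m k > 0 \<and> n k > 0"
    using eventually_conj[OF m_inf[unfolded filterlim_at_top, rule_format, of 1]
      n_inf[unfolded filterlim_at_top, rule_format, of 1]]
    by (auto elim: eventually_mono)
  show "\<exists>\<delta>>0. \<forall>A B :: nat \<Rightarrow> real mat.
       (\<forall>k. dim_row (A k) = m k \<and> dim_col (A k) = n k \<and>
            dim_row (B k) = m k \<and> dim_col (B k) = n k \<and>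
            nuclear_norm (A k) \<le> q * sqrt (real (m k) * real (n k)) \<and>
            nuclear_norm (B k) \<le> q * sqrt (real (m k) * real (n k)) \<and>
            max_norm (A k) \<le> L \<and> max_norm (B k) \<le> L) \<longrightarrow>
       limsup (\<lambda>k. ereal (nfrob_norm ((A k - B k) \<circ>\<^sub>H P k))) \<le> ereal \<delta> \<longrightarrow>
       limsup (\<lambda>k. ereal (nfrob_norm (A k - B k))) \<le> ereal \<epsilon>"
  proof (intro exI[of _ \<delta>] conjI \<delta> allI impI)
    fix A B :: "nat \<Rightarrow> real mat"
    assume AB: "\<forall>k. dim_row (A k) = m k \<and> dim_col (A k) = n k \<and>
            dim_row (B k) = m k \<and> dim_col (B k) = n k \<and>
            nuclear_norm (A k) \<le> q * sqrt (real (m k) * real (n k)) \<and>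
            nuclear_norm (B k) \<le> q * sqrt (real (m k) * real (n k)) \<and>
            max_norm (A k) \<le> L \<and> max_norm (B k) \<le> L"
      and "limsup (\<lambda>k. ereal (nfrob_norm ((A k - B k) \<circ>\<^sub>H P k))) \<le> ereal \<delta>"
    \<comment> \<open>A bound on the limsup gives an eventual bound only above its value; the factor
      2 supplies the room.\<close>
    then have "limsup (\<lambda>k. ereal (nfrob_norm ((A k - B k) \<circ>\<^sub>H P k))) < ereal (2 * \<delta>)"
      using \<delta> by (auto elim: le_less_trans)
    then have "\<forall>\<^sub>F k in sequentially. ereal (nfrob_norm ((A k - B k) \<circ>\<^sub>H P k)) < ereal (2 * \<delta>)"
      by (rule Limsup_lessD)
    then have "\<forall>\<^sub>F k in sequentially. ereal (nfrob_norm (A k - B k)) \<le> ereal \<epsilon>"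
      using ev_er ev_mn
    proof eventually_elim
      case (elim k)
      have nn: "nuclear_norm X \<le> q' * sqrt (real (m k) * real (n k))"
        if "nuclear_norm X \<le> q * sqrt (real (m k) * real (n k))" for X
        using that mult_right_mono[OF q'(2), of "sqrt (real (m k) * real (n k))"] by simp
      let ?h = "nfrob_norm ((A k - B k) \<circ>\<^sub>H P k)"
      have "(nfrob_norm (A k - B k))\<^sup>2 \<le> 2 / c * (?h\<^sup>2 + er k) + 8 * L'\<^sup>2 * measure lborel (sublevel W c)"
        unfolding er_def
        by (rule nfrob_norm_recovery[of "m k" "n k"])
          (use elim AB dimP binP W nn q' L' c in \<open>auto intro: order_trans\<close>)
      also have "\<dots> \<le> 2 / c * ((2 * \<delta>)\<^sup>2 + \<delta>\<^sup>2) + 8 * L'\<^sup>2 * (\<epsilon>\<^sup>2 / (16 * L'\<^sup>2))"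
        using elim c \<mu> by (intro add_mono mult_left_mono power_mono) (auto simp: nfrob_norm_def sum_nonneg)
      also have "\<dots> = \<epsilon>\<^sup>2"
        using c L' \<delta>2 by (simp add: power_mult_distrib field_simps)
      finally show ?case using \<epsilon> by (simp add: power2_le_iff_abs_le)
    qed
    then show "limsup (\<lambda>k. ereal (nfrob_norm (A k - B k))) \<le> ereal \<epsilon>"
      by (rule Limsup_bounded)
  qed
qed

end
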